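(* Let $\mathcal{L}=(L,\wedge,\vee,0,1)$ be a complete lattice, let $X\subseteq L\setminus\{1\}$, and assume that $\mathcal{L}$ is an $X$-top lattice. If $A\subseteq X$ is irreducible (as a subset of the topological space $(X,\tau)$), then $I(A)$ is strongly irreducible in $(\mathcal{C}(L),\wedge)$.
   Context: For $a\in L$ put $V(a)=\{p\in X\mid a\le p\}$. Put $\tau=\{X\setminus V(a)\mid a\in L\}$. The lattice $\mathcal{L}$ is called $X$-top iff the family $\{V(a)\mid a\in L\}$ is closed under finite unions (equivalently $\tau$ is a topology on $X$, whose closed sets are the $V(a)$). For $Y\subseteq X$ put $I(Y)=\bigwedge_{p\in Y}p$ (with the empty meet equal to $1$), and for $a\in L$ put $\sqrt a=I(V(a))$. Put $\mathcal{C}(L)=\{a\in L\mid \sqrt a=a\}$, the set of $X$-radical elements; it is closed under meets of $L$. A subset $A$ of a topological space is irreducible iff it is non-empty and, for any closed sets $F_1,F_2$ with $A\subseteq F_1\cup F_2$, one has $A\subseteq F_1$ or $A\subseteq F_2$. An element $x\in\mathcal{C}(L)\setminus\{1\}$ is strongly irreducible in $(\mathcal{C}(L),\wedge)$ iff for all $a,b\in\mathcal{C}(L)$ with $a\wedge b\le x$ one has $a\le x$ or $b\le x$. *)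

theory Defs
  imports "HOL-Analysis.Abstract_Topology"
begin

text \<open>
  The lattice \<open>L\<close> is the carrier of a type of class \<^class>\<open>complete_lattice\<close>, with
  \<open>0 = bot\<close> and \<open>1 = top\<close>; this class does not exclude the degenerate case \<open>bot = top\<close>.
\<close>

definition variety :: "'a::complete_lattice set \<Rightarrow> 'a \<Rightarrow> 'a set" where
  "variety X a = {p \<in> X. a \<le> p}"

definition X_top :: "'a::complete_lattice set \<Rightarrow> bool" where
  "X_top X \<longleftrightarrow> (\<forall>\<F>. finite \<F> \<and> \<F> \<subseteq> range (variety X) \<longrightarrow> \<Union>\<F> \<in> range (variety X))"

text \<open>
  The operator \<^const>\<open>topology\<close> is meaningful only on families that satisfy
  \<^const>\<open>istopology\<close>; the lemmas below show that this is the case for X-top lattices.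
\<close>

definition X_topology :: "'a::complete_lattice set \<Rightarrow> 'a topology" where
  "X_topology X = topology (\<lambda>U. U \<in> {X - variety X a |a. True})"

text \<open>Note that \<^term>\<open>Inf {} = top\<close>, so the empty meet is \<open>1\<close>.\<close>

definition radical :: "'a::complete_lattice set \<Rightarrow> 'a \<Rightarrow> 'a" where
  "radical X a = Inf (variety X a)"

definition radical_elements :: "'a::complete_lattice set \<Rightarrow> 'a set" where
  "radical_elements X = {a. radical X a = a}"

definition irreducible_in :: "'b topology \<Rightarrow> 'b set \<Rightarrow> bool" where
  "irreducible_in T A \<longleftrightarrow> A \<subseteq> topspace T \<and> A \<noteq> {} \<and>
     (\<forall>F\<^sub>1 F\<^sub>2. closedin T F\<^sub>1 \<and> closedin T F\<^sub>2 \<and> A \<subseteq> F\<^sub>1 \<union> F\<^sub>2 \<longrightarrow> A \<subseteq> F\<^sub>1 \<or> A \<subseteq> F\<^sub>2)"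

text \<open>
  Strong irreducibility in \<open>(C, \<and>)\<close> for a subset \<open>C\<close> closed under the meet of the ambient lattice.
\<close>

definition strongly_irreducible_in :: "'a::complete_lattice set \<Rightarrow> 'a \<Rightarrow> bool" where
  "strongly_irreducible_in C x \<longleftrightarrow> x \<in> C - {top} \<and>
     (\<forall>a\<in>C. \<forall>b\<in>C. inf a b \<le> x \<longrightarrow> a \<le> x \<or> b \<le> x)"

lemma Inf_radical_elements:
  assumes "S \<subseteq> radical_elements X"
  shows "Inf S \<in> radical_elements X"
proof -
  have "Inf (variety X (Inf S)) \<le> a" if "a \<in> S" for a
  proof -
    have "variety X a \<subseteq> variety X (Inf S)"
      using that by (auto simp: variety_def intro: Inf_lower2)
    then have "Inf (variety X (Inf S)) \<le> Inf (variety X a)"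
      by (rule Inf_superset_mono)
    then show ?thesis
      using that assms by (auto simp: radical_elements_def radical_def)
  qed
  moreover have "Inf S \<le> Inf (variety X (Inf S))"
    by (auto simp: variety_def intro: Inf_greatest)
  ultimately show ?thesis
    by (auto simp: radical_elements_def radical_def intro!: antisym Inf_greatest)
qed

lemma istopology_X_topology:
  assumes "X_top X"
  shows "istopology (\<lambda>U. U \<in> {X - variety X a |a. True})"
  unfolding istopology_def
proof (intro conjI allI impI)
  fix S T
  assume "S \<in> {X - variety X a |a. True}" "T \<in> {X - variety X a |a. True}"
  then obtain a b where ab: "S = X - variety X a" "T = X - variety X b" by auto
  have "\<Union>{variety X a, variety X b} \<in> range (variety X)"
    using assms[unfolded X_top_def, rule_format, of "{variety X a, variety X b}"] by simp
  then obtain c where "variety X a \<union> variety X b = variety X c" by auto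
  then have "S \<inter> T = X - variety X c" using ab by auto
  then show "S \<inter> T \<in> {X - variety X a |a. True}" by auto
next
  fix \<K>
  assume K: "\<forall>K\<in>\<K>. K \<in> {X - variety X a |a. True}"
  define S where "S = {a. X - variety X a \<in> \<K>}"
  have "\<Union>\<K> = X - variety X (Sup S)"
  proof -
    have "\<Union>\<K> = (\<Union>a\<in>S. X - variety X a)"
    proof
      show "\<Union>\<K> \<subseteq> (\<Union>a\<in>S. X - variety X a)"
      proof
        fix x assume "x \<in> \<Union>\<K>"
        then obtain U where U: "U \<in> \<K>" "x \<in> U" by blast
        with K obtain a where "U = X - variety X a" by blast
        with U show "x \<in> (\<Union>a\<in>S. X - variety X a)" unfolding S_def by blast
      qed
    qed (auto simp: S_def)
    also have "\<dots> = X - variety X (Sup S)"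
      by (auto simp: variety_def Sup_le_iff)
    finally show ?thesis .
  qed
  then show "\<Union>\<K> \<in> {X - variety X a |a. True}" by auto
qed

lemma openin_X_topology:
  assumes "X_top X"
  shows "openin (X_topology X) U \<longleftrightarrow> (\<exists>a. U = X - variety X a)"
  unfolding X_topology_def topology_inverse'[OF istopology_X_topology[OF assms]] by simp

lemma topspace_X_topology:
  assumes "X_top X" "X \<subseteq> UNIV - {top}"
  shows "topspace (X_topology X) = X"
proof -
  have "X = X - variety X top"
    using assms(2) by (auto simp: variety_def top_unique)
  then have "openin (X_topology X) X"
    unfolding openin_X_topology[OF assms(1)] by (rule exI)
  then have "X \<subseteq> topspace (X_topology X)"
    by (rule openin_subset)
  moreover have "topspace (X_topology X) \<subseteq> X"
    unfolding topspace_def openin_X_topology[OF assms(1)] by blast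
  ultimately show ?thesis by (rule antisym[rotated])
qed

lemma closedin_X_topology:
  assumes "X_top X" "X \<subseteq> UNIV - {top}"
  shows "closedin (X_topology X) F \<longleftrightarrow> F \<in> range (variety X)"
proof
  assume "closedin (X_topology X) F"
  then have "F \<subseteq> X" "\<exists>a. X - F = X - variety X a"
    by (simp_all add: closedin_def openin_X_topology[OF assms(1)] topspace_X_topology[OF assms])
  then obtain a where a: "F \<subseteq> X" "X - F = X - variety X a" by blast
  have "variety X a \<subseteq> X" by (auto simp: variety_def)
  with a have "F = variety X a" by blast
  then show "F \<in> range (variety X)" by simp
next
  assume "F \<in> range (variety X)"
  then obtain a where a: "F = variety X a" by blast
  have "variety X a \<subseteq> X" by (auto simp: variety_def)
  with a show "closedin (X_topology X) F"
    unfolding closedin_def openin_X_topology[OF assms(1)] topspace_X_topology[OF assms]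
    by blast
qed

end

theory Submission
  imports Defs
begin

text \<open>
  The two sides of the statement translate into each other by \<open>a \<le> Inf A \<longleftrightarrow> A \<subseteq> V(a)\<close>, valid for
  \<open>A \<subseteq> X\<close>. On radical elements, meets correspond to unions of closed sets:
  \<open>V(a \<sqinter> b) = V(a) \<union> V(b)\<close> (\<open>variety_inf_radical\<close>). Thus \<open>a \<sqinter> b \<le> Inf A\<close> says that \<open>A\<close> is covered by
  the closed sets \<open>V(a)\<close> and \<open>V(b)\<close>, and irreducibility puts \<open>A\<close> inside one of them. The element
  \<open>Inf A\<close> is radical as a meet of points of \<open>X\<close>, and it differs from \<open>top\<close> because \<open>A\<close> is
  non-empty.
\<close>

lemma le_Inf_iff_subset_variety:
  assumes "A \<subseteq> X"
  shows "a \<le> Inf A \<longleftrightarrow> A \<subseteq> variety X a"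
  using assms by (auto simp: variety_def le_Inf_iff)

text \<open>A point is the least element of its own variety.\<close>

lemma subset_radical_elements: "X \<subseteq> radical_elements X"
proof
  fix p assume "p \<in> X"
  then have "Inf (variety X p) = p"
    by (intro Inf_eqI) (auto simp: variety_def)
  then show "p \<in> radical_elements X"
    by (simp add: radical_elements_def radical_def)
qed

text \<open>
  The X-top condition only says that \<open>V(a) \<union> V(b)\<close> is \<open>V(c)\<close> for some \<open>c\<close>. Radicality pins down \<open>c\<close>
  far enough: \<open>c\<close> lies below every point of \<open>V(a)\<close>, hence below their meet \<open>a\<close>, and likewise below
  \<open>b\<close>. So \<open>c \<le> a \<sqinter> b\<close>, and \<open>V\<close> reverses the order.
\<close>

lemma variety_inf_radical:
  assumes "X_top X" and "a \<in> radical_elements X" and "b \<in> radical_elements X"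
  shows "variety X (inf a b) = variety X a \<union> variety X b"
proof
  have "\<Union>{variety X a, variety X b} \<in> range (variety X)"
    using assms(1)[unfolded X_top_def, rule_format, of "{variety X a, variety X b}"] by simp
  then obtain c where c: "variety X a \<union> variety X b = variety X c" by auto
  have "c \<le> Inf (variety X a)" "c \<le> Inf (variety X b)"
    using c by (auto intro!: Inf_greatest simp: variety_def)
  then have "c \<le> inf a b"
    using assms(2,3) by (simp add: radical_elements_def radical_def)
  then have "variety X (inf a b) \<subseteq> variety X c"
    unfolding variety_def by (blast intro: order_trans)
  with c show "variety X (inf a b) \<subseteq> variety X a \<union> variety X b" by simp
  show "variety X a \<union> variety X b \<subseteq> variety X (inf a b)"
    by (auto simp: variety_def intro: le_infI1 le_infI2)
qed

theorem proposition1p22: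
  fixes X A :: "'a::complete_lattice set"
  assumes "X \<subseteq> UNIV - {top}"
    and "X_top X"
    and "A \<subseteq> X"
    and "irreducible_in (X_topology X) A"
  shows "strongly_irreducible_in (radical_elements X) (Inf A)"
  unfolding strongly_irreducible_in_def
proof (intro conjI ballI impI)
  obtain p where "p \<in> A"
    using assms(4) by (auto simp: irreducible_in_def)
  then have "Inf A \<le> p" "p \<noteq> top"
    using assms(1,3) by (auto intro: Inf_lower)
  then have "Inf A \<noteq> top"
    by (metis top_unique)
  moreover have "Inf A \<in> radical_elements X"
    using assms(3) subset_radical_elements by (intro Inf_radical_elements) blast
  ultimately show "Inf A \<in> radical_elements X - {top}" by simp
next
  fix a b
  assume ab: "a \<in> radical_elements X" "b \<in> radical_elements X" and "inf a b \<le> Inf A"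
  then have "A \<subseteq> variety X a \<union> variety X b"
    using assms(3) variety_inf_radical[OF assms(2) ab] by (simp only: le_Inf_iff_subset_variety)
  moreover have "closedin (X_topology X) (variety X a)" "closedin (X_topology X) (variety X b)"
    using closedin_X_topology[OF assms(2,1)] by simp_all
  ultimately have "A \<subseteq> variety X a \<or> A \<subseteq> variety X b"
    using assms(4) by (auto simp: irreducible_in_def)
  then show "a \<le> Inf A \<or> b \<le> Inf A"
    using assms(3) by (simp add: le_Inf_iff_subset_variety)
qed

end
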